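(* Let $T_{\min}>0$ and let the growth condition (defined in the context) hold for the family $\mathcal S_{\min}(T_{\min})$. The following are equivalent: (i) the impulsive system is strongly UGES over $\mathcal S_{\min}(T_{\min})$; (ii) there exist $p\ge1$, $c\ge1$, $\eta>0$, $\mu\in(0,1)$ and a functional $\bar V:[0,T_{\min}]\times X\to\mathbb R_{\ge0}$, Lipschitz on bounded subsets of $X$ uniformly in $\tau$ and continuous in $\tau$, extended by $\bar V(\tau,\cdot):=\bar V(T_{\min},\cdot)$ for $\tau\ge T_{\min}$, satisfying for all $x\in X$ $$\|x\|^p\le\bar V(\tau,x)\le c\|x\|^p\ \ \forall\tau\in[0,T_{\min}],\qquad \underline D^+\bar V(\tau,x)\le-\eta\bar V(\tau,x)\ \ \forall\tau\in[0,T_{\min}],$$ $$\underline D^+\bar V(T_{\min},x)\le-\eta\bar V(T_{\min},x),\qquad \bar V(0,Jx)\le\mu\bar V(T_{\min},x)$$ (these conditions imply, in particular, that the $C_0$-semigroup $S(t)$ is exponentially stable); (iii) the $C_0$-semigroup $S(t)$ is exponentially stable and the family $\mathcal M=\{JS(\theta):\theta\ge T_{\min}\}$ admits a coercive Lipschitz Lyapunov function uniformly: there exist $p\ge1$, $\hat c\ge1$, $\hat\mu\in(0,1)$ and $V_d:X\to\mathbb R_{\ge0}$, Lipschitz on bounded subsets of $X$, such that $\|x\|^p\le V_d(x)\le\hat c\|x\|^p$ and $V_d(Mx)\le\hat\mu V_d(x)$ for all $x\in X$ and all $M\in\mathcal M$.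
   Context: Setting. $X$ is a Banach space with norm $\|\cdot\|$; $A:D(A)\subset X\to X$ generates a strongly continuous ($C_0$) semigroup $(S(t))_{t\ge0}$ on $X$; $J\in L(X)$ is bounded, $J\neq0$, $JD(A)\subset D(A)$. $\mathcal S_{0,\infty}$ is the set of sequences $\sigma=\{t_k\}_{k\ge1}$ with, setting $t_0:=0$, $t_{k+1}>t_k$ for all $k\ge0$ and $t_k\to\infty$; $\mathbb T_\sigma:=\{t_k:k\ge1\}$. $\mathcal S_{\min}(T_{\min}):=\{\sigma\in\mathcal S_{0,\infty}:t_{k+1}-t_k\ge T_{\min}\ \forall k\ge0\}$. The impulsive system is $\dot x(t)=Ax(t)$ for $t\notin\mathbb T_\sigma$, $x(t)=Jx(t^-)$ for $t\in\mathbb T_\sigma$. Its propagator $U_\sigma(t,s)$, $t\ge s\ge0$, is: $U_\sigma(t,s)=S(t-s)$ if $(s,t]\cap\mathbb T_\sigma=\varnothing$; otherwise, if $t_l<\dots<t_m$ are the impulse times in $(s,t]$, $U_\sigma(t,s)=S(t-t_m)JS(t_m-t_{m-1})J\cdots JS(t_l-s)$. $\kappa_\sigma(t,s):=\#(\mathbb T_\sigma\cap(s,t])$. Strong UGES over a family $\mathcal S$: there exist $M\ge1$, $\alpha>0$, $\rho\in(0,1)$ such that $\|U_\sigma(t,s)\|\le M\rho^{\kappa_\sigma(t,s)}e^{-\alpha(t-s)}$ for all $t\ge s\ge0$ and all $\sigma\in\mathcal S$. Growth condition for $\mathcal S_{\min}(T_{\min})$: there exist a piecewise continuous $g:\mathbb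 R_{\ge0}\to\mathbb R_{>0}$ bounded below by some $c_0>0$, and $\mu_0>1$, such that $\|U_\sigma(t,s)x\|\le g(t-s)\mu_0^{\kappa_\sigma(t,s)}\|x\|$ for all $t\ge s\ge0$, $x\in X$, $\sigma\in\mathcal S_{\min}(T_{\min})$, and $\sup_{\tau\ge0}g(\tau)<\infty$. Functionals. $\bar V$ is Lipschitz on bounded subsets of $X$ uniformly in $\tau$ if for every $r>0$ there is $L_r>0$ with $|\bar V(\tau,x)-\bar V(\tau,y)|\le L_r\|x-y\|$ for all $\|x\|,\|y\|<r$ and all $\tau$ (similarly for $V_d$, without $\tau$). $\underline D^+\bar V(\tau,x):=\liminf_{h\downarrow0}h^{-1}\big(\bar V(\tau+h,S(h)x)-\bar V(\tau,x)\big)$. *)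

theory Defs
  imports "HOL-Analysis.Analysis"
begin

text \<open>Time is represented by all reals, but only the values \<open>S t\<close> with \<open>t \<ge> 0\<close> are ever used.\<close>

definition C0_semigroup :: "(real \<Rightarrow> 'a::banach \<Rightarrow>\<^sub>L 'a) \<Rightarrow> bool" where
  "C0_semigroup S \<longleftrightarrow>
     S 0 = id_blinfun \<and>
     (\<forall>s\<ge>0. \<forall>t\<ge>0. S (s + t) = S s o\<^sub>L S t) \<and>
     (\<forall>x. ((\<lambda>t. blinfun_apply (S t) x) \<longlongrightarrow> x) (at_right 0))"

text \<open>An unbounded operator is a pair of a domain \<open>D\<close> and a function \<open>A\<close> whose values
  outside \<open>D\<close> are irrelevant.\<close>

definition is_generator :: "'a set \<Rightarrow> ('a \<Rightarrow> 'a) \<Rightarrow> (real \<Rightarrow> 'a::banach \<Rightarrow>\<^sub>L 'a) \<Rightarrow> bool" where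
  "is_generator D A S \<longleftrightarrow>
     D = {x. \<exists>y. ((\<lambda>h. (blinfun_apply (S h) x - x) /\<^sub>R h) \<longlongrightarrow> y) (at_right 0)} \<and>
     (\<forall>x\<in>D. ((\<lambda>h. (blinfun_apply (S h) x - x) /\<^sub>R h) \<longlongrightarrow> A x) (at_right 0))"

definition exponentially_stable :: "(real \<Rightarrow> 'a::banach \<Rightarrow>\<^sub>L 'a) \<Rightarrow> bool" where
  "exponentially_stable S \<longleftrightarrow>
     (\<exists>K\<ge>1. \<exists>\<omega>>0. \<forall>t\<ge>0. norm (S t) \<le> K * exp (- \<omega> * t))"

text \<open>A sequence \<open>{t\<^sub>k}\<close>, \<open>k \<ge> 1\<close>, is stored together with the convention \<open>t\<^sub>0 = 0\<close>; the
  index \<open>0\<close> is not an impulse time.\<close>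

definition impulse_seqs :: "(nat \<Rightarrow> real) set" where
  "impulse_seqs = {\<sigma>. \<sigma> 0 = 0 \<and> (\<forall>k. \<sigma> k < \<sigma> (Suc k)) \<and> filterlim \<sigma> at_top sequentially}"

definition impulse_seqs_min :: "real \<Rightarrow> (nat \<Rightarrow> real) set" where
  "impulse_seqs_min T = {\<sigma> \<in> impulse_seqs. \<forall>k. T \<le> \<sigma> (Suc k) - \<sigma> k}"

definition impulse_times :: "(nat \<Rightarrow> real) \<Rightarrow> real set" where
  "impulse_times \<sigma> = \<sigma> ` {1..}"

definition impulse_count :: "(nat \<Rightarrow> real) \<Rightarrow> real \<Rightarrow> real \<Rightarrow> nat" where
  "impulse_count \<sigma> t s = card (impulse_times \<sigma> \<inter> {s<..t})"

text \<open>For a list \<open>[\<tau>\<^sub>1, \<dots>, \<tau>\<^sub>n]\<close> of impulse times,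
  \<open>flow_through S J [\<tau>\<^sub>1, \<dots>, \<tau>\<^sub>n] t s = S (t - \<tau>\<^sub>n) J S (\<tau>\<^sub>n - \<tau>\<^sub>n\<^sub>-\<^sub>1) J \<dots> J S (\<tau>\<^sub>1 - s)\<close>.\<close>

primrec flow_through ::
    "(real \<Rightarrow> 'a::banach \<Rightarrow>\<^sub>L 'a) \<Rightarrow> ('a \<Rightarrow>\<^sub>L 'a) \<Rightarrow> real list \<Rightarrow> real \<Rightarrow> real \<Rightarrow> ('a \<Rightarrow>\<^sub>L 'a)" where
  "flow_through S J [] t s = S (t - s)"
| "flow_through S J (\<tau> # \<tau>s) t s = flow_through S J \<tau>s t \<tau> o\<^sub>L J o\<^sub>L S (\<tau> - s)"

text \<open>The set of impulse times in \<open>(s, t]\<close> is finite because the impulse times tend to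
  infinity, so \<open>sorted_list_of_set\<close> lists it in increasing order.\<close>

definition propagator ::
    "(real \<Rightarrow> 'a::banach \<Rightarrow>\<^sub>L 'a) \<Rightarrow> ('a \<Rightarrow>\<^sub>L 'a) \<Rightarrow> (nat \<Rightarrow> real) \<Rightarrow> real \<Rightarrow> real \<Rightarrow> ('a \<Rightarrow>\<^sub>L 'a)" where
  "propagator S J \<sigma> t s =
     flow_through S J (sorted_list_of_set (impulse_times \<sigma> \<inter> {s<..t})) t s"

definition strongly_UGES ::
    "(real \<Rightarrow> 'a::banach \<Rightarrow>\<^sub>L 'a) \<Rightarrow> ('a \<Rightarrow>\<^sub>L 'a) \<Rightarrow> (nat \<Rightarrow> real) set \<Rightarrow> bool" where
  "strongly_UGES S J \<Sigma> \<longleftrightarrow>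
     (\<exists>M\<ge>1. \<exists>\<alpha>>0. \<exists>\<rho>. 0 < \<rho> \<and> \<rho> < 1 \<and>
        (\<forall>\<sigma>\<in>\<Sigma>. \<forall>s\<ge>0. \<forall>t\<ge>s.
           norm (propagator S J \<sigma> t s) \<le> M * \<rho> ^ impulse_count \<sigma> t s * exp (- \<alpha> * (t - s))))"

definition piecewise_continuous_halfline :: "(real \<Rightarrow> real) \<Rightarrow> bool" where
  "piecewise_continuous_halfline g \<longleftrightarrow>
     (\<forall>T>0. \<exists>F. finite F \<and> continuous_on ({0..T} - F) g) \<and>
     (\<forall>a\<ge>0. \<exists>l. (g \<longlongrightarrow> l) (at_right a)) \<and>
     (\<forall>a>0. \<exists>l. (g \<longlongrightarrow> l) (at_left a))"

definition growth_condition ::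
    "(real \<Rightarrow> 'a::banach \<Rightarrow>\<^sub>L 'a) \<Rightarrow> ('a \<Rightarrow>\<^sub>L 'a) \<Rightarrow> (nat \<Rightarrow> real) set \<Rightarrow> bool" where
  "growth_condition S J \<Sigma> \<longleftrightarrow>
     (\<exists>g c\<^sub>0 \<mu>\<^sub>0. piecewise_continuous_halfline g \<and> c\<^sub>0 > 0 \<and> (\<forall>\<tau>\<ge>0. c\<^sub>0 \<le> g \<tau>) \<and> \<mu>\<^sub>0 > 1 \<and>
        (\<forall>\<sigma>\<in>\<Sigma>. \<forall>s\<ge>0. \<forall>t\<ge>s. \<forall>x.
           norm (blinfun_apply (propagator S J \<sigma> t s) x)
             \<le> g (t - s) * \<mu>\<^sub>0 ^ impulse_count \<sigma> t s * norm x) \<and>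
        bdd_above (g ` {0..}))"

definition lipschitz_on_bounded :: "('a::real_normed_vector \<Rightarrow> real) \<Rightarrow> bool" where
  "lipschitz_on_bounded V \<longleftrightarrow>
     (\<forall>r>0. \<exists>L>0. \<forall>x y. norm x < r \<longrightarrow> norm y < r \<longrightarrow> \<bar>V x - V y\<bar> \<le> L * norm (x - y))"

definition lipschitz_on_bounded_uniformly ::
    "real set \<Rightarrow> (real \<Rightarrow> 'a::real_normed_vector \<Rightarrow> real) \<Rightarrow> bool" where
  "lipschitz_on_bounded_uniformly I V \<longleftrightarrow>
     (\<forall>r>0. \<exists>L>0. \<forall>\<tau>\<in>I. \<forall>x y. norm x < r \<longrightarrow> norm y < r \<longrightarrow>
        \<bar>V \<tau> x - V \<tau> y\<bar> \<le> L * norm (x - y))"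

definition extend_const :: "real \<Rightarrow> (real \<Rightarrow> 'a \<Rightarrow> real) \<Rightarrow> real \<Rightarrow> 'a \<Rightarrow> real" where
  "extend_const T V \<tau> x = (if \<tau> \<le> T then V \<tau> x else V T x)"

text \<open>The lower right Dini derivative is extended-real-valued, since the difference quotients
  may be unbounded.\<close>

definition lower_Dini ::
    "(real \<Rightarrow> 'a::banach \<Rightarrow>\<^sub>L 'a) \<Rightarrow> (real \<Rightarrow> 'a \<Rightarrow> real) \<Rightarrow> real \<Rightarrow> 'a \<Rightarrow> ereal" where
  "lower_Dini S V \<tau> x =
     Liminf (at_right 0) (\<lambda>h. ereal ((V (\<tau> + h) (blinfun_apply (S h) x) - V \<tau> x) / h))"

text \<open>\<open>V\<close> stands for a functional on \<open>[0, T] \<times> X\<close>: only its values at \<open>\<tau> \<in> [0, T]\<close> matter, and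
  the Dini derivative is that of its constant extension beyond \<open>T\<close>.\<close>

definition timer_lyapunov ::
    "(real \<Rightarrow> 'a::banach \<Rightarrow>\<^sub>L 'a) \<Rightarrow> ('a \<Rightarrow>\<^sub>L 'a) \<Rightarrow> real \<Rightarrow>
     real \<Rightarrow> real \<Rightarrow> real \<Rightarrow> real \<Rightarrow> (real \<Rightarrow> 'a \<Rightarrow> real) \<Rightarrow> bool" where
  "timer_lyapunov S J T p c \<eta> \<mu> V \<longleftrightarrow>
     (\<forall>\<tau>\<in>{0..T}. \<forall>x. 0 \<le> V \<tau> x) \<and>
     lipschitz_on_bounded_uniformly {0..T} V \<and>
     (\<forall>x. continuous_on {0..T} (\<lambda>\<tau>. V \<tau> x)) \<and>
     (\<forall>x. \<forall>\<tau>\<in>{0..T}. norm x powr p \<le> V \<tau> x \<and> V \<tau> x \<le> c * norm x powr p) \<and>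
     (\<forall>x. \<forall>\<tau>\<in>{0..T}. lower_Dini S (extend_const T V) \<tau> x \<le> ereal (- \<eta> * V \<tau> x)) \<and>
     (\<forall>x. lower_Dini S (extend_const T V) T x \<le> ereal (- \<eta> * V T x)) \<and>
     (\<forall>x. V 0 (blinfun_apply J x) \<le> \<mu> * V T x)"

definition uniform_lyapunov ::
    "('a::real_normed_vector \<Rightarrow>\<^sub>L 'a) set \<Rightarrow> real \<Rightarrow> real \<Rightarrow> real \<Rightarrow> ('a \<Rightarrow> real) \<Rightarrow> bool" where
  "uniform_lyapunov \<M> p c \<mu> V \<longleftrightarrow>
     (\<forall>x. 0 \<le> V x) \<and>
     lipschitz_on_bounded V \<and>
     (\<forall>x. norm x powr p \<le> V x \<and> V x \<le> c * norm x powr p) \<and>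
     (\<forall>M\<in>\<M>. \<forall>x. V (blinfun_apply M x) \<le> \<mu> * V x)"

end

theory Submission
  imports Defs
begin

text \<open>
  The three conditions are linked in a cycle, (i) to (ii) to (iii) to (i).

  From (i) to (ii), a converse Lyapunov construction with \<open>p = 1\<close>. If every propagator satisfies
  \<open>\<parallel>U t s\<parallel> \<le> M \<rho>\<^sup>\<kappa> exp (- \<alpha> (t - s))\<close>, then the weighted operators
  \<open>\<rho>\<^sup>-\<^sup>\<kappa> exp (\<alpha> (t - s)) U t s\<close> are all bounded by \<open>M\<close>. Let \<open>V \<tau> x\<close> be the supremum of
  the norms of \<open>x\<close> under all weighted operators that a system whose timer shows \<open>\<tau>\<close> can still
  perform (\<open>timer_functional\<close>). Waiting for a time \<open>h\<close>, or jumping once the timer shows \<open>T\<close>, leads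
  to a state whose possible futures are, up to the weights \<open>exp (\<alpha> h)\<close> and \<open>1 / \<rho>\<close>, among those
  of the original state. This gives \<open>V (\<tau> + h) (S h x) \<le> exp (- \<alpha> h) V \<tau> x\<close> and
  \<open>V 0 (J x) \<le> \<rho> V T x\<close>, hence both decay conditions. Every \<open>V \<tau>\<close> is a norm equivalent to the
  original one, hence Lipschitz. Continuity in \<open>\<tau>\<close> comes from the same flow inequality, because
  \<open>V\<close> is monotone in \<open>\<tau>\<close>.

  From (ii) to (iii), the Dini condition integrates to exponential decay of
  \<open>V (min t T) (S t x)\<close> (\<open>lower_right_Dini_decay\<close>). Coercivity turns this into exponential
  stability of the semigroup, and \<open>V 0\<close> is the required discrete functional: a flow of length at
  least \<open>T\<close> brings the timer to \<open>T\<close>, where the jump contracts by \<open>\<mu>\<close>. The growth condition enters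
  here: it bounds the semigroup, which makes its orbits continuous.

  From (iii) to (i), the discrete functional alone yields a factor \<open>\<mu>\<close> per impulse and the
  stability of the semigroup alone a factor \<open>C exp (- a \<theta>)\<close> per interval of length \<open>\<theta>\<close>, where
  the constant \<open>C\<close> would accumulate. A weighted geometric mean of the two bounds has the form
  \<open>\<rho> exp (- \<epsilon> \<theta>)\<close> with \<open>\<rho> < 1\<close> (\<open>min_le_geometric_mean_decay\<close>), and these factors multiply to
  the strong estimate.
\<close>

section \<open>Impulse sequences and propagators\<close>

lemma impulse_seq_strict_mono:
  assumes "\<sigma> \<in> impulse_seqs" shows "strict_mono \<sigma>"
  using assms by (simp add: impulse_seqs_def strict_mono_Suc_iff)

lemma finite_impulse_times:
  assumes "\<sigma> \<in> impulse_seqs"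
  shows "finite (impulse_times \<sigma> \<inter> {s<..t})"
proof -
  have "filterlim \<sigma> at_top sequentially"
    using assms by (simp add: impulse_seqs_def)
  then have "eventually (\<lambda>k. t < \<sigma> k) sequentially"
    by (simp add: filterlim_at_top_dense)
  then obtain N where N: "\<And>k. k \<ge> N \<Longrightarrow> t < \<sigma> k"
    by (auto simp: eventually_sequentially)
  have "impulse_times \<sigma> \<inter> {s<..t} \<subseteq> \<sigma> ` {..<N}"
    using N by (force simp: impulse_times_def not_less[symmetric])
  then show ?thesis
    by (rule finite_subset) simp
qed

lemma impulse_gap:
  assumes \<sigma>: "\<sigma> \<in> impulse_seqs_min T"
    and r: "r \<in> impulse_times \<sigma>" "r' \<in> impulse_times \<sigma>" "r < r'"
  shows "T \<le> r' - r"
proof -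
  have mono: "strict_mono \<sigma>"
    using \<sigma> by (simp add: impulse_seqs_min_def impulse_seq_strict_mono)
  obtain k m where km: "r = \<sigma> k" "r' = \<sigma> m"
    using r by (auto simp: impulse_times_def)
  then have "k < m"
    using r(3) mono by (simp add: strict_mono_less)
  then have "\<sigma> (Suc k) \<le> \<sigma> m"
    using mono by (simp add: strict_mono_less_eq)
  moreover have "T \<le> \<sigma> (Suc k) - \<sigma> k"
    using \<sigma> by (simp add: impulse_seqs_min_def)
  ultimately show ?thesis
    using km by simp
qed

lemma propagator_without_impulse:
  assumes "impulse_times \<sigma> \<inter> {s<..t} = {}"
  shows "propagator S J \<sigma> t s = S (t - s)" and "impulse_count \<sigma> t s = 0"
  unfolding propagator_def impulse_count_def assms by simp_all

text \<open>The propagators are defined through a sorted list of all impulse times. Splitting off the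
  first impulse is the recursion by which all later arguments proceed.\<close>

lemma propagator_first_impulse:
  assumes \<sigma>: "\<sigma> \<in> impulse_seqs"
    and r: "r \<in> impulse_times \<sigma>" "s < r" "r \<le> t"
    and first: "impulse_times \<sigma> \<inter> {s<..<r} = {}"
  shows "propagator S J \<sigma> t s = propagator S J \<sigma> t r o\<^sub>L J o\<^sub>L S (r - s)"
    and "impulse_count \<sigma> t s = Suc (impulse_count \<sigma> t r)"
proof -
  let ?A = "impulse_times \<sigma> \<inter> {s<..t}" and ?B = "impulse_times \<sigma> \<inter> {r<..t}"
  have fin: "finite ?A" "finite ?B"
    using \<sigma> by (simp_all only: finite_impulse_times)
  have A: "?A = insert r ?B"
    using r first by (auto simp: not_less_iff_gr_or_eq)
  have min: "Min ?A = r"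
    using fin unfolding A by (intro Min_eqI) auto
  have diff: "?A - {r} = ?B"
    unfolding A by auto
  have "?A \<noteq> {}"
    using A by blast
  then have "sorted_list_of_set ?A = r # sorted_list_of_set ?B"
    using sorted_list_of_set_nonempty[OF fin(1)] unfolding min diff by simp
  then show "propagator S J \<sigma> t s = propagator S J \<sigma> t r o\<^sub>L J o\<^sub>L S (r - s)"
    by (simp add: propagator_def)
  show "impulse_count \<sigma> t s = Suc (impulse_count \<sigma> t r)"
    unfolding impulse_count_def A using fin(2) by (subst card_insert_disjoint) auto
qed

lemma impulse_count_zeroD:
  assumes "\<sigma> \<in> impulse_seqs" "impulse_count \<sigma> t s = 0"
  shows "propagator S J \<sigma> t s = S (t - s)"
  using assms finite_impulse_times[OF assms(1)]
  by (intro propagator_without_impulse) (simp add: impulse_count_def)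

lemma impulse_count_SucE:
  assumes \<sigma>: "\<sigma> \<in> impulse_seqs" and count: "impulse_count \<sigma> t s = Suc n"
  obtains r where "r \<in> impulse_times \<sigma>" "s < r" "r \<le> t" "impulse_count \<sigma> t r = n"
    and "propagator S J \<sigma> t s = propagator S J \<sigma> t r o\<^sub>L J o\<^sub>L S (r - s)"
proof -
  let ?A = "impulse_times \<sigma> \<inter> {s<..t}"
  have fin: "finite ?A"
    by (rule finite_impulse_times[OF \<sigma>])
  have "?A \<noteq> {}"
    using count unfolding impulse_count_def by (metis card.empty nat.distinct(1))
  then have "Min ?A \<in> ?A"
    using fin by (rule Min_in[rotated])
  then have r: "Min ?A \<in> impulse_times \<sigma>" "s < Min ?A" "Min ?A \<le> t"
    by auto
  have "impulse_times \<sigma> \<inter> {s<..<Min ?A} = {}"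
  proof (intro equals0I)
    fix q assume q: "q \<in> impulse_times \<sigma> \<inter> {s<..<Min ?A}"
    then have "q \<in> ?A" using r(3) by auto
    then have "Min ?A \<le> q" using fin by (rule Min_le[rotated])
    then show False using q by auto
  qed
  from propagator_first_impulse[OF \<sigma> r this] count show thesis
    by (intro that[OF r]) simp_all
qed

text \<open>Such sequences make the semigroup itself a propagator, so that estimates for propagators
  apply to it.\<close>

lemma late_impulse_sequence:
  assumes "T > 0" "b \<ge> 0"
  obtains \<sigma> where "\<sigma> \<in> impulse_seqs_min T" "impulse_times \<sigma> \<inter> {..b} = {}"
proof
  let ?\<sigma> = "\<lambda>k. real k * (T + b)"
  have "filterlim ?\<sigma> at_top sequentially"
    using assms by (intro filterlim_at_top_mult_tendsto_pos[OF tendsto_const]) (auto simp: filterlim_real_sequentially)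
  then show "?\<sigma> \<in> impulse_seqs_min T"
    using assms by (auto simp: impulse_seqs_min_def impulse_seqs_def algebra_simps)
  have "b < real k * (T + b)" if "k \<ge> 1" for k
  proof -
    have "b < 1 * (T + b)"
      using assms by simp
    also have "\<dots> \<le> real k * (T + b)"
      using that assms by (intro mult_right_mono) auto
    finally show ?thesis .
  qed
  then show "impulse_times ?\<sigma> \<inter> {..b} = {}"
    by (fastforce simp: impulse_times_def dest: leD)
qed

text \<open>The new first impulse time is \<open>r\<close>, because \<open>\<sigma> 0 = 0\<close>: the clock of \<open>\<sigma>\<close> starts at the new
  impulse.\<close>

definition prepend_impulse :: "real \<Rightarrow> (nat \<Rightarrow> real) \<Rightarrow> nat \<Rightarrow> real" where
  "prepend_impulse r \<sigma> k = (case k of 0 \<Rightarrow> 0 | Suc j \<Rightarrow> r + \<sigma> j)"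

lemma prepend_impulse_in_seqs_min:
  assumes "T > 0" "T \<le> r" "\<sigma> \<in> impulse_seqs_min T"
  shows "prepend_impulse r \<sigma> \<in> impulse_seqs_min T"
proof -
  have "filterlim (\<lambda>k. r + \<sigma> k) at_top sequentially"
    using assms by (intro filterlim_tendsto_add_at_top[OF tendsto_const])
      (simp add: impulse_seqs_min_def impulse_seqs_def)
  then have "filterlim (\<lambda>k. prepend_impulse r \<sigma> (Suc k)) at_top sequentially"
    by (simp add: prepend_impulse_def)
  then have "filterlim (prepend_impulse r \<sigma>) at_top sequentially"
    by (simp only: filterlim_sequentially_Suc)
  moreover have "T \<le> prepend_impulse r \<sigma> (Suc k) - prepend_impulse r \<sigma> k" for k
    using assms by (cases k) (auto simp: prepend_impulse_def impulse_seqs_min_def impulse_seqs_def)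
  moreover from this have "prepend_impulse r \<sigma> k < prepend_impulse r \<sigma> (Suc k)" for k
    using assms(1) by (smt (verit))
  ultimately show ?thesis
    by (simp add: impulse_seqs_min_def impulse_seqs_def) (simp add: prepend_impulse_def)
qed

lemma impulse_times_prepend:
  assumes "\<sigma> \<in> impulse_seqs"
  shows "impulse_times (prepend_impulse r \<sigma>) = insert r ((+) r ` impulse_times \<sigma>)"
proof -
  have nz: "{1..} = insert 1 (Suc ` {1::nat..})"
  proof (intro set_eqI)
    show "k \<in> {1..} \<longleftrightarrow> k \<in> insert 1 (Suc ` {1..})" for k
      by (cases k) auto
  qed
  have "prepend_impulse r \<sigma> 1 = r"
    using assms by (simp add: prepend_impulse_def impulse_seqs_def)
  moreover have "prepend_impulse r \<sigma> (Suc k) = r + \<sigma> k" for k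
    by (simp add: prepend_impulse_def)
  ultimately show ?thesis
    unfolding impulse_times_def by (subst nz) (simp add: image_image)
qed

lemma flow_through_shift:
  "flow_through S J (map ((+) r) ts) (r + t) (r + s) = flow_through S J ts t s"
  by (induction ts arbitrary: s) simp_all

lemma sorted_list_of_set_shift:
  fixes r :: real
  assumes "finite A"
  shows "sorted_list_of_set ((+) r ` A) = map ((+) r) (sorted_list_of_set A)"
proof -
  have "sorted_wrt (<) (map ((+) r) (sorted_list_of_set A))"
    by (simp add: sorted_wrt_map)
  moreover have "set (map ((+) r) (sorted_list_of_set A)) = (+) r ` A"
    using assms by simp
  ultimately show ?thesis
    using assms by (metis sorted_list_of_set.idem_if_sorted_distinct strict_sorted_iff)
qed

lemma propagator_prepend_shift:
  assumes \<sigma>: "\<sigma> \<in> impulse_seqs" and s: "s \<ge> 0"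
  shows "propagator S J (prepend_impulse r \<sigma>) (r + t) (r + s) = propagator S J \<sigma> t s"
    and "impulse_count (prepend_impulse r \<sigma>) (r + t) (r + s) = impulse_count \<sigma> t s"
proof -
  have times: "impulse_times (prepend_impulse r \<sigma>) \<inter> {r + s<..r + t}
      = (+) r ` (impulse_times \<sigma> \<inter> {s<..t})"
    using s unfolding impulse_times_prepend[OF \<sigma>] by auto
  show "propagator S J (prepend_impulse r \<sigma>) (r + t) (r + s) = propagator S J \<sigma> t s"
    unfolding propagator_def times sorted_list_of_set_shift[OF finite_impulse_times[OF \<sigma>]]
    by (rule flow_through_shift)
  show "impulse_count (prepend_impulse r \<sigma>) (r + t) (r + s) = impulse_count \<sigma> t s"
    unfolding impulse_count_def times by (rule card_image) simp
qed

section \<open>Elementary estimates\<close>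

lemma le_root_of_powr_le:
  fixes a b C p :: real
  assumes "a powr p \<le> C * b powr p" "p > 0" "a \<ge> 0" "b \<ge> 0" "C \<ge> 0"
  shows "a \<le> C powr (1 / p) * b"
proof -
  have "a = (a powr p) powr (1 / p)"
    using assms by (simp add: powr_powr)
  also have "\<dots> \<le> (C * b powr p) powr (1 / p)"
    using assms by (intro powr_mono2) auto
  also have "\<dots> = C powr (1 / p) * b"
    using assms by (simp add: powr_mult powr_powr)
  finally show ?thesis .
qed

text \<open>The minimum is at most \<open>\<mu>\<^sup>1\<^sup>-\<^sup>l (C exp (- a \<theta>))\<^sup>l\<close> for every \<open>l \<in> [0, 1]\<close>. For small
  \<open>l\<close> the constant \<open>\<mu> (C / \<mu>)\<^sup>l\<close> is still below \<open>1\<close>, and the factor \<open>exp (- a l \<theta>)\<close>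
  survives.\<close>

lemma min_le_geometric_mean_decay:
  fixes \<mu> C a :: real
  assumes \<mu>: "0 < \<mu>" "\<mu> < 1" and C: "C \<ge> 1" and a: "a > 0"
  obtains \<rho> \<epsilon> where "0 < \<rho>" "\<rho> < 1" "0 < \<epsilon>" "\<epsilon> \<le> a"
    and "\<And>\<theta>. min \<mu> (C * exp (- a * \<theta>)) \<le> \<rho> * exp (- \<epsilon> * \<theta>)"
proof
  define q where "q = ln C - ln \<mu>"
  \<comment> \<open>chosen such that \<open>\<mu> (C / \<mu>)\<^sup>l = sqrt \<mu>\<close>\<close>
  define l where "l = - ln \<mu> / (2 * q)"
  have ln: "ln \<mu> < 0" "ln C \<ge> 0"
    using \<mu> C by auto
  then have q: "q > 0"
    by (simp add: q_def)
  then have lq: "l * q = - ln \<mu> / 2"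
    by (simp add: l_def)
  have l: "0 < l" "l \<le> 1"
    using ln q by (auto simp: l_def field_simps) (simp add: q_def)
  show "0 < sqrt \<mu>" "sqrt \<mu> < 1"
    using \<mu> by auto
  show "0 < a * l" "a * l \<le> a"
    using l a by auto
  show "min \<mu> (C * exp (- a * \<theta>)) \<le> sqrt \<mu> * exp (- (a * l) * \<theta>)" for \<theta>
  proof -
    let ?m = "ln \<mu>" and ?n = "ln C - a * \<theta>"
    have "min ?m ?n = (1 - l) * min ?m ?n + l * min ?m ?n"
      by (simp add: algebra_simps)
    also have "\<dots> \<le> (1 - l) * ?m + l * ?n"
      using l by (intro add_mono mult_left_mono) auto
    also have "\<dots> = ?m + l * q - (a * l) * \<theta>"
      by (simp add: q_def algebra_simps)
    also have "\<dots> = ?m / 2 - (a * l) * \<theta>"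
      unfolding lq by simp
    finally have "exp (min ?m ?n) \<le> exp (?m / 2 - (a * l) * \<theta>)"
      by simp
    also have "\<dots> = sqrt \<mu> * exp (- (a * l) * \<theta>)"
      using \<mu> by (simp add: exp_diff exp_minus field_simps flip: ln_sqrt)
    also have "exp (min ?m ?n) = min (exp ?m) (exp ?n)"
      by (simp add: min_def)
    also have "exp ?n = C * exp (- a * \<theta>)"
      using C by (simp add: exp_diff exp_minus field_simps)
    finally show ?thesis
      using \<mu> by simp
  qed
qed

text \<open>A comparison with the strict supersolution \<open>u t = exp (- \<eta> t) (f 0 + \<epsilon> t)\<close>. As the
  condition is on a lower derivative, it says something about some small \<open>h > 0\<close> only and does
  not exclude that \<open>f\<close> rises above \<open>u\<close> in between; the argument therefore considers the last time
  at which \<open>f \<le> u\<close>, after which \<open>f\<close> lies above \<open>u\<close> at all times up to \<open>b\<close>.\<close>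

lemma lower_right_Dini_decay:
  fixes f :: "real \<Rightarrow> real"
  assumes cont: "continuous_on {0..b} f" and b: "b \<ge> 0" and \<eta>: "\<eta> > 0" and f0: "f 0 \<ge> 0"
    and dini: "\<And>t. 0 \<le> t \<Longrightarrow> t < b \<Longrightarrow>
      Liminf (at_right 0) (\<lambda>h. ereal ((f (t + h) - f t) / h)) \<le> ereal (- \<eta> * f t)"
  shows "f b \<le> exp (- \<eta> * b) * f 0"
proof (rule field_le_epsilon)
  fix e :: real assume e: "e > 0"
  \<comment> \<open>makes \<open>u b\<close> exceed \<open>exp (- \<eta> b) f 0\<close> by less than \<open>e\<close>\<close>
  define \<epsilon> where "\<epsilon> = e / (exp (- \<eta> * b) * (b + 1))"
  have \<epsilon>: "\<epsilon> > 0"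
    using e b by (simp add: \<epsilon>_def)
  define u where "u t = exp (- \<eta> * t) * (f 0 + \<epsilon> * t)" for t
  define E where "E = {t \<in> {0..b}. f t \<le> u t}"
  have "closed E"
    unfolding E_def u_def by (intro continuous_on_closed_Collect_le cont continuous_intros)
  moreover have "E \<subseteq> {0..b}"
    by (auto simp: E_def)
  ultimately have "compact E"
    using bounded_subset[OF bounded_closed_interval] by (simp only: compact_eq_bounded_closed) blast
  moreover have "0 \<in> E"
    using b by (simp add: E_def u_def)
  ultimately obtain t where t: "t \<in> E" and last: "\<And>s. s \<in> E \<Longrightarrow> s \<le> t"
    using compact_attains_sup[of E] by blast
  have t': "0 \<le> t" "t \<le> b" "f t \<le> u t"
    using t by (auto simp: E_def)
  have "t = b"
  proof (rule ccontr)
    assume "t \<noteq> b"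
    then have tb: "t < b"
      using t' by simp
    \<comment> \<open>the margin by which \<open>u\<close> is a strict supersolution on \<open>[0, b]\<close>\<close>
    define m where "m = \<epsilon> * exp (- \<eta> * b)"
    have m: "m > 0"
      using \<epsilon> by (simp add: m_def)
    have ev: "eventually (\<lambda>h. 0 < h \<and> h < min (b - t) (1 / \<eta>)) (at_right (0::real))"
      using tb \<eta> by (intro eventually_at_right_real[of 0 "min (b - t) (1 / \<eta>)", simplified greaterThanLessThan_iff]) auto
    have "eventually (\<lambda>h. ereal (- \<eta> * f t + m) \<le> ereal ((f (t + h) - f t) / h)) (at_right 0)"
      using ev
    proof eventually_elim
      case (elim h)
      then have h: "0 < h" "t + h \<le> b" "\<eta> * h \<le> 1"
        using \<eta> by (auto simp: field_simps)
      have "t + h \<notin> E"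
        using last[of "t + h"] h by auto
      then have "u (t + h) < f (t + h)"
        using h t' by (auto simp: E_def)
      moreover have "(1 - \<eta> * h) * f t + m * h \<le> u (t + h)"
      proof -
        have u0: "u t \<ge> 0"
          using f0 \<epsilon> t' by (simp add: u_def)
        have "(1 - \<eta> * h) * f t \<le> (1 - \<eta> * h) * u t"
          using h t' by (intro mult_left_mono) auto
        also have "\<dots> \<le> exp (- \<eta> * h) * u t"
          using u0 exp_ge_add_one_self[of "- \<eta> * h"] by (intro mult_right_mono) auto
        finally have 1: "(1 - \<eta> * h) * f t \<le> exp (- \<eta> * h) * u t" .
        have 2: "m * h \<le> exp (- \<eta> * (t + h)) * (\<epsilon> * h)"
          unfolding m_def using \<epsilon> h \<eta> by (simp add: mult_ac)
        have "u (t + h) = exp (- \<eta> * h) * u t + exp (- \<eta> * (t + h)) * (\<epsilon> * h)"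
          by (simp add: u_def algebra_simps flip: exp_add)
        then show ?thesis
          using 1 2 by simp
      qed
      ultimately have "(- \<eta> * f t + m) * h \<le> f (t + h) - f t"
        by (simp add: algebra_simps)
      then show ?case
        using h by (simp add: pos_le_divide_eq)
    qed
    then have "ereal (- \<eta> * f t + m) \<le> Liminf (at_right 0) (\<lambda>h. ereal ((f (t + h) - f t) / h))"
      by (rule Liminf_bounded)
    also have "\<dots> \<le> ereal (- \<eta> * f t)"
      using dini t' tb by simp
    finally show False
      using m by simp
  qed
  then have "f b \<le> u b"
    using t' by simp
  also have "u b = exp (- \<eta> * b) * f 0 + (exp (- \<eta> * b) * \<epsilon>) * b"
    by (simp add: u_def algebra_simps)
  also have "exp (- \<eta> * b) * \<epsilon> = e / (b + 1)"
    by (simp add: \<epsilon>_def)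
  also have "e / (b + 1) * b \<le> e"
    using b e by (simp add: field_simps)
  finally show "f b \<le> exp (- \<eta> * b) * f 0 + e"
    by simp
qed

section \<open>The converse Lyapunov functional\<close>

lemma C0_semigroup_zero: "C0_semigroup S \<Longrightarrow> S 0 = id_blinfun"
  by (simp add: C0_semigroup_def)

lemma C0_semigroup_add:
  "C0_semigroup S \<Longrightarrow> s \<ge> 0 \<Longrightarrow> t \<ge> 0 \<Longrightarrow> S (s + t) = S s o\<^sub>L S t"
  by (simp add: C0_semigroup_def)

text \<open>The operators \<open>\<rho>\<^sup>-\<^sup>\<kappa> exp (\<alpha> (t - \<tau>)) U t \<tau>\<close> of impulse sequences with gaps at least
  \<open>T\<close> that are followed from time \<open>\<tau>\<close> on, with the first impulse at time \<open>T\<close> or later, described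
  by what happens first: either no impulse at all, or an impulse after a waiting time \<open>\<theta>\<close>, which
  resets the timer to \<open>0\<close>. The waiting time is positive because a propagator from \<open>\<tau>\<close> ignores an
  impulse at \<open>\<tau>\<close> itself. In this description no impulse sequence has to be shifted or cut when the
  timer advances.\<close>

inductive weighted_transition ::
    "(real \<Rightarrow> 'a::banach \<Rightarrow>\<^sub>L 'a) \<Rightarrow> ('a \<Rightarrow>\<^sub>L 'a) \<Rightarrow> real \<Rightarrow> real \<Rightarrow> real \<Rightarrow>
     real \<Rightarrow> ('a \<Rightarrow>\<^sub>L 'a) \<Rightarrow> bool"
  for S J T \<alpha> \<rho> where
  free_flow: "t \<ge> 0 \<Longrightarrow> weighted_transition S J T \<alpha> \<rho> \<tau> (exp (\<alpha> * t) *\<^sub>R S t)"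
| impulse: "weighted_transition S J T \<alpha> \<rho> 0 L \<Longrightarrow> \<theta> > 0 \<Longrightarrow> T \<le> \<tau> + \<theta> \<Longrightarrow>
    weighted_transition S J T \<alpha> \<rho> \<tau> ((exp (\<alpha> * \<theta>) / \<rho>) *\<^sub>R (L o\<^sub>L J o\<^sub>L S \<theta>))"

lemma weighted_transition_is_propagator:
  assumes "weighted_transition S J T \<alpha> \<rho> \<tau> L" and "T > 0" "\<tau> \<ge> 0"
  shows "\<exists>\<sigma>\<in>impulse_seqs_min T. \<exists>t\<ge>\<tau>.
    L = (exp (\<alpha> * (t - \<tau>)) / \<rho> ^ impulse_count \<sigma> t \<tau>) *\<^sub>R propagator S J \<sigma> t \<tau>"
  using assms
proof induction
  case (free_flow t \<tau>)
  obtain \<sigma> where \<sigma>: "\<sigma> \<in> impulse_seqs_min T" "impulse_times \<sigma> \<inter> {..\<tau> + t} = {}"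
    using late_impulse_sequence[of T "\<tau> + t"] free_flow by auto
  then have "impulse_times \<sigma> \<inter> {\<tau><..\<tau> + t} = {}"
    by auto
  from propagator_without_impulse(1)[OF this, of S J] propagator_without_impulse(2)[OF this] show ?case
    using \<sigma>(1) free_flow by (intro bexI[of _ \<sigma>] exI[of _ "\<tau> + t"]) auto
next
  case (impulse L \<theta> \<tau>)
  then obtain \<sigma> t where \<sigma>: "\<sigma> \<in> impulse_seqs_min T" and t: "t \<ge> 0"
    and L: "L = (exp (\<alpha> * t) / \<rho> ^ impulse_count \<sigma> t 0) *\<^sub>R propagator S J \<sigma> t 0"
    by auto
  define r where "r = \<tau> + \<theta>"
  have r: "T \<le> r" "\<tau> < r"
    using impulse by (auto simp: r_def)
  let ?\<sigma> = "prepend_impulse r \<sigma>"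
  have \<sigma>': "?\<sigma> \<in> impulse_seqs_min T"
    using prepend_impulse_in_seqs_min impulse.prems(1) r(1) \<sigma> .
  have seq: "\<sigma> \<in> impulse_seqs" "?\<sigma> \<in> impulse_seqs"
    using \<sigma> \<sigma>' by (auto simp: impulse_seqs_min_def)
  have pos: "q > 0" if "q \<in> impulse_times \<sigma>" for q
  proof -
    from \<open>q \<in> impulse_times \<sigma>\<close> obtain k where "q = \<sigma> k" "k \<ge> 1"
      by (auto simp: impulse_times_def)
    moreover have "\<sigma> 0 = 0"
      using seq(1) by (simp add: impulse_seqs_def)
    ultimately show ?thesis
      using strict_monoD[OF impulse_seq_strict_mono[OF seq(1)], of 0 k] by simp
  qed
  note times = impulse_times_prepend[OF seq(1), of r]
  have first: "impulse_times ?\<sigma> \<inter> {\<tau><..<r} = {}"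
    using pos unfolding times by fastforce
  have "r \<in> impulse_times ?\<sigma>"
    unfolding times by simp
  from propagator_first_impulse[OF seq(2) this r(2) _ first, of "r + t"] t
  have "propagator S J ?\<sigma> (r + t) \<tau> = propagator S J ?\<sigma> (r + t) r o\<^sub>L J o\<^sub>L S \<theta>"
    and "impulse_count ?\<sigma> (r + t) \<tau> = Suc (impulse_count ?\<sigma> (r + t) r)"
    by (auto simp: r_def)
  with propagator_prepend_shift(1)[OF seq(1), of 0 S J r t]
    propagator_prepend_shift(2)[OF seq(1), of 0 r t]
  have "propagator S J ?\<sigma> (r + t) \<tau> = propagator S J \<sigma> t 0 o\<^sub>L J o\<^sub>L S \<theta>"
    and "impulse_count ?\<sigma> (r + t) \<tau> = Suc (impulse_count \<sigma> t 0)"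
    by auto
  moreover have "exp (\<alpha> * (r + t - \<tau>)) = exp (\<alpha> * \<theta>) * exp (\<alpha> * t)"
    by (simp add: r_def algebra_simps flip: exp_add)
  ultimately show ?case
    using \<sigma>' t r unfolding L
    by (intro bexI[of _ ?\<sigma>] exI[of _ "r + t"])
      (auto simp: bounded_bilinear.scaleR_left[OF bounded_bilinear_blinfun_compose])
qed

lemma weighted_transition_norm_le:
  assumes bound: "\<forall>\<sigma>\<in>impulse_seqs_min T. \<forall>s\<ge>0. \<forall>t\<ge>s.
      norm (propagator S J \<sigma> t s) \<le> M * \<rho> ^ impulse_count \<sigma> t s * exp (- \<alpha> * (t - s))"
    and \<rho>: "\<rho> > 0" and T: "T > 0" "\<tau> \<ge> 0"
    and L: "weighted_transition S J T \<alpha> \<rho> \<tau> L"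
  shows "norm L \<le> M"
proof -
  obtain \<sigma> t where \<sigma>: "\<sigma> \<in> impulse_seqs_min T" and t: "t \<ge> \<tau>"
    and L: "L = (exp (\<alpha> * (t - \<tau>)) / \<rho> ^ impulse_count \<sigma> t \<tau>) *\<^sub>R propagator S J \<sigma> t \<tau>"
    using weighted_transition_is_propagator[OF L T] by auto
  let ?w = "exp (\<alpha> * (t - \<tau>)) / \<rho> ^ impulse_count \<sigma> t \<tau>"
  have "norm L = ?w * norm (propagator S J \<sigma> t \<tau>)"
    using \<rho> by (simp add: L)
  also have "\<dots> \<le> ?w * (M * \<rho> ^ impulse_count \<sigma> t \<tau> * exp (- \<alpha> * (t - \<tau>)))"
    using \<rho> bound \<sigma> t T(2) by (intro mult_left_mono) auto
  also have "\<dots> = M"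
    using \<rho> by (simp add: exp_minus)
  finally show ?thesis .
qed

lemma weighted_transition_mono:
  assumes "weighted_transition S J T \<alpha> \<rho> \<tau> L" "\<tau> \<le> \<tau>'"
  shows "weighted_transition S J T \<alpha> \<rho> \<tau>' L"
  using assms by cases (auto intro: weighted_transition.intros)

text \<open>Flowing for a time \<open>h\<close> first merely lengthens the initial waiting time. The cap at \<open>T\<close> is
  harmless, since at timer value \<open>T\<close> every waiting time is already admissible.\<close>

lemma weighted_transition_precompose_flow:
  assumes S: "C0_semigroup S" and "h \<ge> 0"
    and L: "weighted_transition S J T \<alpha> \<rho> (min (\<tau> + h) T) L"
  shows "weighted_transition S J T \<alpha> \<rho> \<tau> (exp (\<alpha> * h) *\<^sub>R (L o\<^sub>L S h))"
  using L
proof cases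
  case (free_flow t)
  then have "exp (\<alpha> * h) *\<^sub>R (L o\<^sub>L S h) = exp (\<alpha> * (t + h)) *\<^sub>R S (t + h)"
    using S \<open>h \<ge> 0\<close>
    by (intro blinfun_eqI)
      (simp add: C0_semigroup_add scaleR_blinfun.rep_eq ring_distribs exp_add mult.commute)
  then show ?thesis
    using weighted_transition.free_flow[of "t + h"] free_flow \<open>h \<ge> 0\<close> by simp
next
  case (impulse L' \<theta>)
  then have "exp (\<alpha> * h) *\<^sub>R (L o\<^sub>L S h) = (exp (\<alpha> * (\<theta> + h)) / \<rho>) *\<^sub>R (L' o\<^sub>L J o\<^sub>L S (\<theta> + h))"
    using S \<open>h \<ge> 0\<close>
    by (intro blinfun_eqI)
      (simp add: C0_semigroup_add scaleR_blinfun.rep_eq ring_distribs exp_add mult.commute)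
  moreover have "weighted_transition S J T \<alpha> \<rho> \<tau> ((exp (\<alpha> * (\<theta> + h)) / \<rho>) *\<^sub>R (L' o\<^sub>L J o\<^sub>L S (\<theta> + h)))"
    using impulse \<open>h \<ge> 0\<close> by (intro weighted_transition.impulse) auto
  ultimately show ?thesis
    by simp
qed

definition timer_functional ::
    "(real \<Rightarrow> 'a::banach \<Rightarrow>\<^sub>L 'a) \<Rightarrow> ('a \<Rightarrow>\<^sub>L 'a) \<Rightarrow> real \<Rightarrow> real \<Rightarrow> real \<Rightarrow> real \<Rightarrow> 'a \<Rightarrow> real" where
  "timer_functional S J T \<alpha> \<rho> \<tau> x =
     (SUP L\<in>{L. weighted_transition S J T \<alpha> \<rho> \<tau> L}. norm (blinfun_apply L x))"

text \<open>The converse theorem. Once \<open>weighted_transition_norm_le\<close> makes the suprema finite, the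
  properties of \<open>timer_functional\<close> are closure properties of the set of weighted transitions.\<close>

lemma strongly_UGES_imp_timer_lyapunov:
  assumes S: "C0_semigroup S" and T: "T > 0"
    and uges: "strongly_UGES S J (impulse_seqs_min T)"
  shows "\<exists>p\<ge>1. \<exists>c\<ge>1. \<exists>\<eta>>0. \<exists>\<mu> V. 0 < \<mu> \<and> \<mu> < 1 \<and> timer_lyapunov S J T p c \<eta> \<mu> V"
proof -
  obtain M \<alpha> \<rho> where M: "M \<ge> 1" and \<alpha>: "\<alpha> > 0" and \<rho>: "0 < \<rho>" "\<rho> < 1"
    and bound: "\<forall>\<sigma>\<in>impulse_seqs_min T. \<forall>s\<ge>0. \<forall>t\<ge>s.
      norm (propagator S J \<sigma> t s) \<le> M * \<rho> ^ impulse_count \<sigma> t s * exp (- \<alpha> * (t - s))"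
    using uges unfolding strongly_UGES_def by blast
  let ?W = "weighted_transition S J T \<alpha> \<rho>"
  let ?V = "timer_functional S J T \<alpha> \<rho>"
  have norm_le: "norm (blinfun_apply L x) \<le> M * norm x" if "?W \<tau> L" "\<tau> \<ge> 0" for \<tau> L x
    using weighted_transition_norm_le[OF bound \<rho>(1) T that(2,1)]
    by (meson mult_right_mono norm_blinfun norm_ge_zero order_trans)
  have free: "?W \<tau> (S 0)" for \<tau>
    using weighted_transition.free_flow[of 0] by simp
  have V_ge: "norm (blinfun_apply L x) \<le> ?V \<tau> x" if "?W \<tau> L" "\<tau> \<ge> 0" for \<tau> L x
    unfolding timer_functional_def using that norm_le
    by (intro cSUP_upper bdd_aboveI2) auto
  have V_le: "?V \<tau> x \<le> b" if "\<And>L. ?W \<tau> L \<Longrightarrow> norm (blinfun_apply L x) \<le> b" for \<tau> x b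
    unfolding timer_functional_def using that free by (intro cSUP_least) auto
  have lower: "norm x \<le> ?V \<tau> x" if "\<tau> \<ge> 0" for \<tau> x
    using V_ge[OF free that, of x] C0_semigroup_zero[OF S] by simp
  have upper: "?V \<tau> x \<le> M * norm x" if "\<tau> \<ge> 0" for \<tau> x
    using V_le norm_le that by blast
  have lip_one: "?V \<tau> x \<le> ?V \<tau> y + M * norm (x - y)" if "\<tau> \<ge> 0" for \<tau> x y
  proof (rule V_le)
    fix L assume L: "?W \<tau> L"
    have "norm (blinfun_apply L x) \<le> norm (blinfun_apply L y) + norm (blinfun_apply L (x - y))"
      using norm_triangle_ineq[of "blinfun_apply L y" "blinfun_apply L (x - y)"]
      by (simp add: blinfun.diff_right)
    with V_ge[OF L that, of y] norm_le[OF L that, of "x - y"]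
    show "norm (blinfun_apply L x) \<le> ?V \<tau> y + M * norm (x - y)"
      by simp
  qed
  have lip: "\<bar>?V \<tau> x - ?V \<tau> y\<bar> \<le> M * norm (x - y)" if "\<tau> \<ge> 0" for \<tau> x y
    using lip_one[OF that, of x y] lip_one[OF that, of y x] by (simp add: norm_minus_commute)
  have mono: "?V \<tau> x \<le> ?V \<tau>' x" if "0 \<le> \<tau>" "\<tau> \<le> \<tau>'" for \<tau> \<tau>' x
    using that V_ge weighted_transition_mono by (intro V_le) fastforce
  have flow: "?V (min (\<tau> + h) T) (blinfun_apply (S h) x) \<le> exp (- \<alpha> * h) * ?V \<tau> x"
    if "\<tau> \<ge> 0" "h \<ge> 0" for \<tau> h x
  proof (rule V_le)
    fix L assume "?W (min (\<tau> + h) T) L"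
    from V_ge[OF weighted_transition_precompose_flow[OF S that(2) this] that(1), of x]
    show "norm (blinfun_apply L (blinfun_apply (S h) x)) \<le> exp (- \<alpha> * h) * ?V \<tau> x"
      by (simp add: scaleR_blinfun.rep_eq exp_minus field_simps)
  qed
  have jump: "?V 0 (blinfun_apply J x) \<le> \<rho> * ?V T x" for x
  proof (rule V_le)
    fix L assume L: "?W 0 L"
    \<comment> \<open>An immediate impulse is not a weighted transition, but the limit of those with waiting
      time \<open>\<theta>\<close> tending to \<open>0\<close>.\<close>
    have "((\<lambda>\<theta>. norm (blinfun_apply L (blinfun_apply J (blinfun_apply (S \<theta>) x))) * exp (\<alpha> * \<theta>))
        \<longlongrightarrow> norm (blinfun_apply L (blinfun_apply J x)) * exp (\<alpha> * 0)) (at_right 0)"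
      using S unfolding C0_semigroup_def by (intro tendsto_intros) auto
    moreover have "norm (blinfun_apply L (blinfun_apply J (blinfun_apply (S \<theta>) x))) * exp (\<alpha> * \<theta>) \<le> \<rho> * ?V T x"
      if "\<theta> > 0" for \<theta>
      using V_ge[OF weighted_transition.impulse[OF L that, of T], of x] T that \<rho>
      by (simp add: scaleR_blinfun.rep_eq field_simps)
    then have "eventually (\<lambda>\<theta>. norm (blinfun_apply L (blinfun_apply J (blinfun_apply (S \<theta>) x)))
        * exp (\<alpha> * \<theta>) \<le> \<rho> * ?V T x) (at_right 0)"
      by (intro eventually_at_rightI[of 0 1]) auto
    ultimately show "norm (blinfun_apply L (blinfun_apply J x)) \<le> \<rho> * ?V T x"
      using tendsto_upperbound by force
  qed
  have V_nonneg: "?V \<tau> x \<ge> 0" if "\<tau> \<ge> 0" for \<tau> x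
    using lower[OF that, of x] norm_ge_zero order_trans by blast
  \<comment> \<open>The flow inequality bounds \<open>V \<tau>' (S (\<tau>' - \<tau>) x)\<close> by \<open>V \<tau> x\<close>, and the Lipschitz bound
    replaces \<open>S (\<tau>' - \<tau>) x\<close> by \<open>x\<close>.\<close>
  have modulus: "\<bar>?V \<tau>' x - ?V \<tau> x\<bar> \<le> M * norm (blinfun_apply (S (\<tau>' - \<tau>)) x - x)"
    if "0 \<le> \<tau>" "\<tau> \<le> \<tau>'" "\<tau>' \<le> T" for \<tau> \<tau>' x
  proof -
    have "?V \<tau>' x \<le> ?V \<tau>' (blinfun_apply (S (\<tau>' - \<tau>)) x) + M * norm (blinfun_apply (S (\<tau>' - \<tau>)) x - x)"
      using lip_one[of \<tau>'] that by (simp add: norm_minus_commute)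
    also have "?V \<tau>' (blinfun_apply (S (\<tau>' - \<tau>)) x) \<le> exp (- \<alpha> * (\<tau>' - \<tau>)) * ?V \<tau> x"
      using flow[of \<tau> "\<tau>' - \<tau>" x] that by simp
    also have "\<dots> \<le> 1 * ?V \<tau> x"
      using that \<alpha> V_nonneg by (intro mult_right_mono) auto
    finally show ?thesis
      using mono[OF that(1,2)] by simp
  qed
  have cont: "continuous_on {0..T} (\<lambda>\<tau>. ?V \<tau> x)" for x
  proof -
    have lim: "((\<lambda>h. M * norm (blinfun_apply (S h) x - x)) \<longlongrightarrow> M * norm (x - x)) (at_right 0)"
      using S unfolding C0_semigroup_def by (intro tendsto_intros) auto
    show ?thesis
      unfolding continuous_on_iff
    proof (intro ballI allI impI)
      fix \<tau> e :: real assume \<tau>: "\<tau> \<in> {0..T}" and e: "e > 0"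
      from lim e have "eventually (\<lambda>h. M * norm (blinfun_apply (S h) x - x) < e) (at_right 0)"
        using order_tendstoD(2) by fastforce
      then obtain d where d: "d > 0" "\<And>h. 0 < h \<Longrightarrow> h < d \<Longrightarrow> M * norm (blinfun_apply (S h) x - x) < e"
        by (auto simp: eventually_at_right_field)
      have close: "\<bar>?V \<tau>2 x - ?V \<tau>1 x\<bar> < e" if "0 \<le> \<tau>1" "\<tau>1 < \<tau>2" "\<tau>2 \<le> T" "\<tau>2 - \<tau>1 < d" for \<tau>1 \<tau>2
        using modulus[of \<tau>1 \<tau>2 x] d(2)[of "\<tau>2 - \<tau>1"] that by simp
      have "dist (?V \<tau>' x) (?V \<tau> x) < e" if "\<tau>' \<in> {0..T}" "dist \<tau>' \<tau> < d" for \<tau>'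
        using that \<tau> e close[of \<tau> \<tau>'] close[of \<tau>' \<tau>]
        by (cases \<tau> \<tau>' rule: linorder_cases) (auto simp: dist_real_def)
      then show "\<exists>d>0. \<forall>\<tau>'\<in>{0..T}. dist \<tau>' \<tau> < d \<longrightarrow> dist (?V \<tau>' x) (?V \<tau> x) < e"
        using d(1) by blast
    qed
  qed
  have dini: "lower_Dini S (extend_const T ?V) \<tau> x \<le> ereal (- \<alpha> * ?V \<tau> x)" if "\<tau> \<in> {0..T}" for \<tau> x
  proof -
    have ext: "extend_const T ?V s = ?V (min s T)" for s
      by (auto simp: extend_const_def min_def)
    have \<tau>: "\<tau> \<ge> 0" "min \<tau> T = \<tau>"
      using that by auto
    have "((\<lambda>h. exp (- \<alpha> * h)) has_real_derivative - \<alpha>) (at 0)"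
      by (auto intro!: derivative_eq_intros)
    then have "((\<lambda>h. (exp (- \<alpha> * h) - 1) / h) \<longlongrightarrow> - \<alpha>) (at 0)"
      by (simp add: DERIV_def)
    then have "((\<lambda>h. (exp (- \<alpha> * h) - 1) / h) \<longlongrightarrow> - \<alpha>) (at_right 0)"
      by (rule tendsto_mono[rotated]) (simp add: at_le)
    then have "((\<lambda>h. (exp (- \<alpha> * h) - 1) / h * ?V \<tau> x) \<longlongrightarrow> - \<alpha> * ?V \<tau> x) (at_right 0)"
      by (rule tendsto_mult_right)
    then have "((\<lambda>h. ereal ((exp (- \<alpha> * h) - 1) / h * ?V \<tau> x)) \<longlongrightarrow> ereal (- \<alpha> * ?V \<tau> x)) (at_right 0)"
      by simp
    then have "Liminf (at_right 0) (\<lambda>h. ereal ((exp (- \<alpha> * h) - 1) / h * ?V \<tau> x)) = ereal (- \<alpha> * ?V \<tau> x)"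
      by (rule lim_imp_Liminf[rotated]) simp
    moreover have "lower_Dini S (extend_const T ?V) \<tau> x
        \<le> Liminf (at_right 0) (\<lambda>h. ereal ((exp (- \<alpha> * h) - 1) / h * ?V \<tau> x))"
      unfolding lower_Dini_def ext \<tau>(2)
    proof (intro Liminf_mono eventually_at_rightI[of 0 1])
      fix h :: real assume "h \<in> {0<..<1}"
      then show "ereal ((?V (min (\<tau> + h) T) (blinfun_apply (S h) x) - ?V \<tau> x) / h)
          \<le> ereal ((exp (- \<alpha> * h) - 1) / h * ?V \<tau> x)"
        using flow[OF \<tau>(1), of h x] by (simp add: field_simps)
    qed simp
    ultimately show ?thesis
      by simp
  qed
  have "timer_lyapunov S J T 1 M \<alpha> \<rho> ?V"
    unfolding timer_lyapunov_def lipschitz_on_bounded_uniformly_def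
    using V_nonneg lower upper cont dini jump lip M T by (auto intro!: exI[of _ M])
  moreover have "(1::real) \<ge> 1"
    by simp
  ultimately show ?thesis
    using M \<alpha> \<rho> by blast
qed

section \<open>From the timer functional to the discrete one\<close>

lemma growth_condition_imp_semigroup_bounded:
  assumes growth: "growth_condition S J (impulse_seqs_min T)" and T: "T > 0"
  shows "\<exists>G. \<forall>t\<ge>0. norm (S t) \<le> G"
proof -
  obtain g c \<mu> where c: "c > 0" "\<forall>t\<ge>0. c \<le> g t"
    and g: "\<forall>\<sigma>\<in>impulse_seqs_min T. \<forall>s\<ge>0. \<forall>t\<ge>s. \<forall>x.
      norm (blinfun_apply (propagator S J \<sigma> t s) x) \<le> g (t - s) * \<mu> ^ impulse_count \<sigma> t s * norm x"
    and bdd: "bdd_above (g ` {0..})"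
    using growth unfolding growth_condition_def by blast
  from bdd obtain G where G: "\<And>t. t \<ge> 0 \<Longrightarrow> g t \<le> G"
    by (auto simp: bdd_above_def)
  have "norm (S t) \<le> G" if t: "t \<ge> 0" for t
  proof -
    obtain \<sigma> where \<sigma>: "\<sigma> \<in> impulse_seqs_min T" "impulse_times \<sigma> \<inter> {..t} = {}"
      using late_impulse_sequence[OF T t] .
    then have "impulse_times \<sigma> \<inter> {0<..t} = {}"
      by auto
    then have "norm (blinfun_apply (S t) x) \<le> g t * norm x" for x
      using g[rule_format, OF \<sigma>(1), of 0 t x] t by (simp add: propagator_without_impulse)
    then have "norm (S t) \<le> g t"
      using c t by (intro norm_blinfun_bound) (meson less_imp_le order_trans, simp)
    with G[OF t] show ?thesis
      by simp
  qed
  then show ?thesis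
    by blast
qed

text \<open>Strong continuity at \<open>0\<close> gives right continuity everywhere; the bound \<open>G\<close> gives left
  continuity, through \<open>S v x - S u x = S u (S (v - u) x - x)\<close> for \<open>u < v\<close>.\<close>

lemma C0_semigroup_orbit_continuous:
  assumes S: "C0_semigroup S" and G: "\<forall>t\<ge>0. norm (S t) \<le> G"
  shows "continuous_on {0..} (\<lambda>t. blinfun_apply (S t) x)"
  unfolding continuous_on_iff
proof (intro ballI allI impI)
  fix t e :: real assume t: "t \<in> {0..}" and e: "e > 0"
  have "((\<lambda>h. G * norm (blinfun_apply (S h) x - x)) \<longlongrightarrow> G * norm (x - x)) (at_right 0)"
    using S unfolding C0_semigroup_def by (intro tendsto_intros) auto
  with e have "eventually (\<lambda>h. G * norm (blinfun_apply (S h) x - x) < e) (at_right 0)"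
    using order_tendstoD(2) by fastforce
  then obtain d where d: "d > 0" "\<And>h. 0 < h \<Longrightarrow> h < d \<Longrightarrow> G * norm (blinfun_apply (S h) x - x) < e"
    by (auto simp: eventually_at_right_field)
  have close: "norm (blinfun_apply (S v) x - blinfun_apply (S u) x) < e" if "0 \<le> u" "u < v" "v - u < d" for u v
  proof -
    have "S v = S u o\<^sub>L S (v - u)"
      using C0_semigroup_add[OF S, of u "v - u"] that by simp
    then have "blinfun_apply (S v) x - blinfun_apply (S u) x = blinfun_apply (S u) (blinfun_apply (S (v - u)) x - x)"
      by (simp add: blinfun.diff_right)
    also have "norm \<dots> \<le> G * norm (blinfun_apply (S (v - u)) x - x)"
      using G that(1) by (meson mult_right_mono norm_blinfun norm_ge_zero order_trans)
    also have "\<dots> < e"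
      using d(2) that by simp
    finally show ?thesis .
  qed
  have "dist (blinfun_apply (S t') x) (blinfun_apply (S t) x) < e" if "t' \<in> {0..}" "dist t' t < d" for t'
    using that t e close[of t t'] close[of t' t]
    by (cases t t' rule: linorder_cases) (auto simp: dist_norm norm_minus_commute)
  then show "\<exists>d>0. \<forall>t'\<in>{0..}. dist t' t < d \<longrightarrow> dist (blinfun_apply (S t') x) (blinfun_apply (S t) x) < e"
    using d(1) by blast
qed

text \<open>The Dini condition holds along the whole trajectory that starts with timer \<open>0\<close>: the constant
  extension of \<open>V\<close> does not distinguish timer values beyond \<open>T\<close> from \<open>T\<close>.\<close>

lemma timer_lyapunov_flow_decay:
  assumes S: "C0_semigroup S" and G: "\<forall>t\<ge>0. norm (S t) \<le> G" and T: "T > 0" and \<eta>: "\<eta> > 0"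
    and V: "timer_lyapunov S J T p c \<eta> \<mu> V" and b: "b \<ge> 0"
  shows "V (min b T) (blinfun_apply (S b) x) \<le> exp (- \<eta> * b) * V 0 x"
proof -
  define f where "f t = V (min t T) (blinfun_apply (S t) x)" for t
  have ext: "extend_const T V s = V (min s T)" for s
    by (auto simp: extend_const_def min_def)
  have Vcont: "continuous_on {0..T} (\<lambda>\<tau>. V \<tau> y)" for y
    using V by (simp add: timer_lyapunov_def)
  have S0: "S 0 = id_blinfun"
    by (rule C0_semigroup_zero[OF S])
  define r where "r = G * norm x + 1"
  have "0 \<le> G"
    using G by (meson norm_ge_zero order_refl order_trans)
  then have "r > 0"
    by (simp add: r_def add_nonneg_pos)
  have less_r: "norm (blinfun_apply (S t) x) < r" if "t \<ge> 0" for t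
  proof -
    have "norm (blinfun_apply (S t) x) \<le> G * norm x"
      using G that by (meson mult_right_mono norm_blinfun norm_ge_zero order_trans)
    then show ?thesis by (simp add: r_def)
  qed
  obtain L where "L > 0" and L: "\<And>\<tau> y z. \<tau> \<in> {0..T} \<Longrightarrow> norm y < r \<Longrightarrow> norm z < r \<Longrightarrow>
      \<bar>V \<tau> y - V \<tau> z\<bar> \<le> L * norm (y - z)"
    using V \<open>r > 0\<close> unfolding timer_lyapunov_def lipschitz_on_bounded_uniformly_def by meson
  have "continuous_on {0..b} f"
    unfolding continuous_on_def
  proof
    fix t assume t: "t \<in> {0..b}"
    let ?F = "at t within {0..b}"
    have "continuous_on {0..b} (\<lambda>u. blinfun_apply (S u) x)"
      by (rule continuous_on_subset[OF C0_semigroup_orbit_continuous[OF S G]]) auto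
    then have "((\<lambda>u. blinfun_apply (S u) x) \<longlongrightarrow> blinfun_apply (S t) x) ?F"
      using t unfolding continuous_on_def by blast
    then have "((\<lambda>u. L * norm (blinfun_apply (S u) x - blinfun_apply (S t) x)) \<longlongrightarrow> L * norm (blinfun_apply (S t) x - blinfun_apply (S t) x)) ?F"
      by (intro tendsto_mult tendsto_const tendsto_norm tendsto_diff)
    then have "((\<lambda>u. L * norm (blinfun_apply (S u) x - blinfun_apply (S t) x)) \<longlongrightarrow> 0) ?F"
      by simp
    then have 1: "((\<lambda>u. f u - V (min u T) (blinfun_apply (S t) x)) \<longlongrightarrow> 0) ?F"
      using L less_r t T unfolding f_def
      by (elim Lim_null_comparison[rotated]) (auto simp: eventually_at_filter)
    have "continuous_on {0..b} (\<lambda>u. V (min u T) (blinfun_apply (S t) x))"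
      using T by (intro continuous_on_compose2[OF Vcont]) (auto intro!: continuous_intros)
    then have 2: "((\<lambda>u. V (min u T) (blinfun_apply (S t) x)) \<longlongrightarrow> f t) ?F"
      using t by (simp add: continuous_on_def f_def)
    show "(f \<longlongrightarrow> f t) ?F"
      using tendsto_add[OF 1 2] by simp
  qed
  moreover have "Liminf (at_right 0) (\<lambda>h. ereal ((f (t + h) - f t) / h)) \<le> ereal (- \<eta> * f t)"
    if t: "0 \<le> t" for t
  proof -
    have "Liminf (at_right 0) (\<lambda>h. ereal ((f (t + h) - f t) / h))
        = lower_Dini S (extend_const T V) (min t T) (blinfun_apply (S t) x)"
      unfolding lower_Dini_def ext
    proof (intro Liminf_eq eventually_at_rightI[of 0 1])
      fix h :: real assume h: "h \<in> {0<..<1}"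
      have "S (t + h) = S h o\<^sub>L S t"
        using C0_semigroup_add[OF S, of h t] t h by (simp add: add.commute)
      moreover have "min (min t T + h) T = min (t + h) T"
        using h by auto
      ultimately show "ereal ((f (t + h) - f t) / h)
          = ereal ((V (min (min t T + h) T) (blinfun_apply (S h) (blinfun_apply (S t) x))
              - V (min (min t T) T) (blinfun_apply (S t) x)) / h)"
        by (simp add: f_def)
    qed simp
    also have "\<dots> \<le> ereal (- \<eta> * f t)"
      using V T t unfolding timer_lyapunov_def f_def by auto
    finally show ?thesis .
  qed
  moreover have "f 0 \<ge> 0"
    using V T by (simp add: f_def timer_lyapunov_def)
  ultimately have "f b \<le> exp (- \<eta> * b) * f 0"
    using b \<eta> by (intro lower_right_Dini_decay) auto
  then show ?thesis
    using T S0 by (simp add: f_def)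
qed

text \<open>Between the jump that resets the timer and the next one, the flow lasts at least \<open>T\<close>, so
  the decay of \<open>V\<close> along the flow and the jump condition combine to a contraction of
  \<open>V 0\<close>.\<close>

lemma timer_lyapunov_imp_uniform_lyapunov:
  assumes S: "C0_semigroup S" and G: "\<forall>t\<ge>0. norm (S t) \<le> G" and T: "T > 0"
    and p: "p \<ge> 1" and c: "c \<ge> 1" and \<eta>: "\<eta> > 0" and \<mu>: "\<mu> > 0"
    and V: "timer_lyapunov S J T p c \<eta> \<mu> V"
  shows "exponentially_stable S"
    and "\<exists>V. uniform_lyapunov {J o\<^sub>L S \<theta> | \<theta>. \<theta> \<ge> T} p c \<mu> V"
proof -
  note decay = timer_lyapunov_flow_decay[OF S G T \<eta> V]
  have coercive: "norm x powr p \<le> V \<tau> x" "V \<tau> x \<le> c * norm x powr p" "0 \<le> V \<tau> x"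
    if "\<tau> \<in> {0..T}" for \<tau> x
    using V that by (auto simp: timer_lyapunov_def)
  have "norm (S t) \<le> c powr (1 / p) * exp (- (\<eta> / p) * t)" if t: "t \<ge> 0" for t
  proof (rule norm_blinfun_bound)
    fix x
    have "norm (blinfun_apply (S t) x) powr p \<le> exp (- \<eta> * t) * V 0 x"
      using coercive(1)[of "min t T"] decay[OF t, of x] t T by (auto intro: order_trans)
    also have "\<dots> \<le> exp (- \<eta> * t) * (c * norm x powr p)"
      using coercive(2)[of 0 x] T by (intro mult_left_mono) auto
    finally have "norm (blinfun_apply (S t) x) \<le> (exp (- \<eta> * t) * c) powr (1 / p) * norm x"
      using p c by (intro le_root_of_powr_le) auto
    then show "norm (blinfun_apply (S t) x) \<le> c powr (1 / p) * exp (- (\<eta> / p) * t) * norm x"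
      using c by (simp add: powr_mult exp_powr_real mult.commute)
  qed simp
  moreover have "c powr (1 / p) \<ge> 1" "\<eta> / p > 0"
    using c p \<eta> by (auto intro: ge_one_powr_ge_zero)
  ultimately show "exponentially_stable S"
    unfolding exponentially_stable_def by blast
  have contract: "V 0 (blinfun_apply J (blinfun_apply (S \<theta>) x)) \<le> \<mu> * V 0 x" if \<theta>: "\<theta> \<ge> T" for \<theta> x
  proof -
    have "V 0 (blinfun_apply J (blinfun_apply (S \<theta>) x)) \<le> \<mu> * V T (blinfun_apply (S \<theta>) x)"
      using V by (simp add: timer_lyapunov_def)
    also have "V T (blinfun_apply (S \<theta>) x) \<le> exp (- \<eta> * \<theta>) * V 0 x"
      using decay[of \<theta> x] \<theta> T by (simp add: min_absorb2)
    also have "\<dots> \<le> 1 * V 0 x"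
      using \<theta> T \<eta> coercive(3)[of 0] by (intro mult_right_mono) auto
    finally show ?thesis
      using \<mu> by simp
  qed
  have "lipschitz_on_bounded (V 0)"
    using V T unfolding timer_lyapunov_def lipschitz_on_bounded_uniformly_def lipschitz_on_bounded_def
    by (metis atLeastAtMost_iff less_imp_le order_refl)
  then have "uniform_lyapunov {J o\<^sub>L S \<theta> | \<theta>. \<theta> \<ge> T} p c \<mu> (V 0)"
    unfolding uniform_lyapunov_def using coercive T contract by auto
  then show "\<exists>V. uniform_lyapunov {J o\<^sub>L S \<theta> | \<theta>. \<theta> \<ge> T} p c \<mu> V"
    by blast
qed

section \<open>From the discrete functional to uniform exponential stability\<close>

text \<open>The estimate is an induction over the impulses, with the functional measured right after each
  of them. Only the interval before the first impulse may be shorter than \<open>T\<close>; there the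
  contraction is not available, which costs a factor \<open>C / \<rho>\<close> once. The final step takes \<open>p\<close>-th
  roots.\<close>

lemma uniform_lyapunov_imp_strongly_UGES:
  fixes J :: "'a::banach \<Rightarrow>\<^sub>L 'a"
  assumes stable: "exponentially_stable S" and p: "p \<ge> 1" and c: "c \<ge> 1" and \<mu>: "0 < \<mu>" "\<mu> < 1"
    and V: "uniform_lyapunov {J o\<^sub>L S \<theta> | \<theta>. \<theta> \<ge> T} p c \<mu> V" and T: "T > 0"
  shows "strongly_UGES S J (impulse_seqs_min T)"
proof -
  obtain K \<omega> where K: "K \<ge> 1" and \<omega>: "\<omega> > 0"
    and S: "\<And>t. t \<ge> 0 \<Longrightarrow> norm (S t) \<le> K * exp (- \<omega> * t)"
    using stable unfolding exponentially_stable_def by blast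
  have coercive: "norm x powr p \<le> V x" "V x \<le> c * norm x powr p" "0 \<le> V x" for x
    using V by (auto simp: uniform_lyapunov_def)
  \<comment> \<open>large enough to serve both for \<open>S \<theta>\<close> and for \<open>J S \<theta>\<close>\<close>
  define B where "B = (norm J + 1) * K"
  define C where "C = c * B powr p"
  define a where "a = \<omega> * p"
  have B: "B \<ge> K" "B \<ge> norm J * K" "B \<ge> 1"
    using K add_increasing[of "norm J * K" 1 K] by (auto simp: B_def ring_distribs)
  have "B powr p \<ge> 1"
    using B p by (intro ge_one_powr_ge_zero) auto
  then have C: "C \<ge> B powr p" "C \<ge> 1"
    using c mult_mono[of 1 c "B powr p" "B powr p"] by (auto simp: C_def)
  have a: "a > 0"
    using \<omega> p by (simp add: a_def)
  have powr_bound: "norm y powr p \<le> B powr p * exp (- a * \<theta>) * norm x powr p"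
    if "norm y \<le> B * exp (- \<omega> * \<theta>) * norm x" for x y :: 'a and \<theta>
  proof -
    have "norm y powr p \<le> (B * exp (- \<omega> * \<theta>) * norm x) powr p"
      using that p by (intro powr_mono2) auto
    then show ?thesis
      using B p by (simp add: powr_mult exp_powr_real a_def mult_ac)
  qed
  have S_apply: "norm (blinfun_apply (S \<theta>) x) \<le> K * exp (- \<omega> * \<theta>) * norm x" if "\<theta> \<ge> 0" for \<theta> x
    using S[OF that] by (meson mult_right_mono norm_blinfun norm_ge_zero order_trans)
  have free: "norm (blinfun_apply (S \<theta>) x) powr p \<le> C * exp (- a * \<theta>) * norm x powr p"
    if \<theta>: "\<theta> \<ge> 0" for \<theta> x
  proof -
    have "norm (blinfun_apply (S \<theta>) x) \<le> B * exp (- \<omega> * \<theta>) * norm x"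
      using S_apply[OF \<theta>, of x] B by (elim order_trans) (intro mult_right_mono, auto)
    from powr_bound[OF this] show ?thesis
      using C by (elim order_trans) (intro mult_right_mono, auto)
  qed
  have jump: "V (blinfun_apply J (blinfun_apply (S \<theta>) x)) \<le> C * exp (- a * \<theta>) * norm x powr p"
    if \<theta>: "\<theta> \<ge> 0" for \<theta> x
  proof -
    have "norm (blinfun_apply J (blinfun_apply (S \<theta>) x)) \<le> norm J * norm (blinfun_apply (S \<theta>) x)"
      by (rule norm_blinfun)
    also have "\<dots> \<le> norm J * (K * exp (- \<omega> * \<theta>) * norm x)"
      using S_apply[OF \<theta>] by (intro mult_left_mono) auto
    also have "\<dots> = (norm J * K) * (exp (- \<omega> * \<theta>) * norm x)"
      by simp
    also have "\<dots> \<le> B * (exp (- \<omega> * \<theta>) * norm x)"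
      using B by (intro mult_right_mono) auto
    finally have "norm (blinfun_apply J (blinfun_apply (S \<theta>) x)) powr p
        \<le> B powr p * exp (- a * \<theta>) * norm x powr p"
      by (intro powr_bound) simp
    then have "c * norm (blinfun_apply J (blinfun_apply (S \<theta>) x)) powr p
        \<le> c * (B powr p * exp (- a * \<theta>) * norm x powr p)"
      using c by (intro mult_left_mono) auto
    with coercive(2) show ?thesis
      by (fastforce intro: order_trans simp: C_def mult.assoc)
  qed
  have seq: "\<sigma> \<in> impulse_seqs" if "\<sigma> \<in> impulse_seqs_min T" for \<sigma>
    using that by (simp add: impulse_seqs_min_def)
  obtain \<rho> \<epsilon> where \<rho>: "0 < \<rho>" "\<rho> < 1" and \<epsilon>: "0 < \<epsilon>" "\<epsilon> \<le> a"
    and min: "\<And>\<theta>. min \<mu> (C * exp (- a * \<theta>)) \<le> \<rho> * exp (- \<epsilon> * \<theta>)"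
    using min_le_geometric_mean_decay[OF \<mu> C(2) a] by blast
  have slower: "exp (- a * t) \<le> exp (- \<epsilon> * t)" if "t \<ge> 0" for t
    using \<epsilon> that by (simp add: mult_right_mono)
  have contract: "V (blinfun_apply J (blinfun_apply (S \<theta>) x)) \<le> \<rho> * exp (- \<epsilon> * \<theta>) * V x"
    if \<theta>: "\<theta> \<ge> T" for \<theta> x
  proof -
    have "V (blinfun_apply J (blinfun_apply (S \<theta>) x)) \<le> \<mu> * V x"
      using V \<theta> unfolding uniform_lyapunov_def by (metis (mono_tags, lifting) blinfun_apply_blinfun_compose mem_Collect_eq)
    moreover have "V (blinfun_apply J (blinfun_apply (S \<theta>) x)) \<le> C * exp (- a * \<theta>) * V x"
    proof -
      have "C * exp (- a * \<theta>) * norm x powr p \<le> C * exp (- a * \<theta>) * V x"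
        using coercive(1) C by (intro mult_left_mono) auto
      with jump[of \<theta> x] \<theta> T show ?thesis
        by simp
    qed
    ultimately have "V (blinfun_apply J (blinfun_apply (S \<theta>) x)) \<le> min \<mu> (C * exp (- a * \<theta>)) * V x"
      by (simp add: min_def)
    also have "\<dots> \<le> \<rho> * exp (- \<epsilon> * \<theta>) * V x"
      using min coercive(3) by (intro mult_right_mono) auto
    finally show ?thesis .
  qed
  have from_impulse: "norm (blinfun_apply (propagator S J \<sigma> t r) x) powr p
      \<le> C * \<rho> ^ impulse_count \<sigma> t r * exp (- \<epsilon> * (t - r)) * V x"
    if \<sigma>: "\<sigma> \<in> impulse_seqs_min T" and r: "r \<in> impulse_times \<sigma>" "r \<le> t" for \<sigma> t r x
    using r
  proof (induction "impulse_count \<sigma> t r" arbitrary: r x)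
    case 0
    have "C * exp (- a * (t - r)) * norm x powr p \<le> C * exp (- \<epsilon> * (t - r)) * V x"
      using 0 C coercive slower[of "t - r"] by (intro mult_mono) auto
    with free[of "t - r" x] 0 show ?case
      using impulse_count_zeroD[OF seq[OF \<sigma>], of t r S J] by simp
  next
    case (Suc n)
    obtain q where q: "q \<in> impulse_times \<sigma>" "r < q" "q \<le> t" and n: "impulse_count \<sigma> t q = n"
      and split: "propagator S J \<sigma> t r = propagator S J \<sigma> t q o\<^sub>L J o\<^sub>L S (q - r)"
      using impulse_count_SucE[OF seq[OF \<sigma>] Suc(2)[symmetric], of S J] by blast
    have gap: "q - r \<ge> T"
      using impulse_gap[OF \<sigma> Suc.prems(1) q(1,2)] .
    let ?y = "blinfun_apply J (blinfun_apply (S (q - r)) x)"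
    have "norm (blinfun_apply (propagator S J \<sigma> t r) x) powr p
        \<le> C * \<rho> ^ n * exp (- \<epsilon> * (t - q)) * V ?y"
      using Suc.hyps(1)[of q ?y] q n unfolding split by simp
    also have "\<dots> \<le> C * \<rho> ^ n * exp (- \<epsilon> * (t - q)) * (\<rho> * exp (- \<epsilon> * (q - r)) * V x)"
      using contract[OF gap] C \<rho> by (intro mult_left_mono) auto
    also have "\<dots> = C * \<rho> ^ Suc n * (exp (- \<epsilon> * (t - q)) * exp (- \<epsilon> * (q - r))) * V x"
      by simp
    also have "exp (- \<epsilon> * (t - q)) * exp (- \<epsilon> * (q - r)) = exp (- \<epsilon> * (t - r))"
      by (simp add: algebra_simps flip: exp_add)
    finally show ?case
      using Suc(2) by simp
  qed
  define M where "M = C\<^sup>2 / \<rho>"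
  have "C * 1 \<le> C * (C / \<rho>)"
    using C \<rho> by (intro mult_left_mono) auto
  then have M: "C \<le> M" "M \<ge> 1"
    using C by (auto simp: M_def power2_eq_square)
  have bound: "norm (blinfun_apply (propagator S J \<sigma> t s) x) powr p
      \<le> M * \<rho> ^ impulse_count \<sigma> t s * exp (- \<epsilon> * (t - s)) * norm x powr p"
    if \<sigma>: "\<sigma> \<in> impulse_seqs_min T" and s: "s \<le> t" for \<sigma> s t x
  proof (cases "impulse_count \<sigma> t s")
    case 0
    have "C * exp (- a * (t - s)) * norm x powr p \<le> M * exp (- \<epsilon> * (t - s)) * norm x powr p"
      using s C M slower[of "t - s"] by (intro mult_right_mono mult_mono) auto
    with free[of "t - s" x] s 0 show ?thesis
      using impulse_count_zeroD[OF seq[OF \<sigma>] 0, of S J] by simp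
  next
    case (Suc n)
    obtain r where r: "r \<in> impulse_times \<sigma>" "s < r" "r \<le> t" and n: "impulse_count \<sigma> t r = n"
      and split: "propagator S J \<sigma> t s = propagator S J \<sigma> t r o\<^sub>L J o\<^sub>L S (r - s)"
      using impulse_count_SucE[OF seq[OF \<sigma>] Suc, of S J] by blast
    let ?y = "blinfun_apply J (blinfun_apply (S (r - s)) x)"
    have "norm (blinfun_apply (propagator S J \<sigma> t s) x) powr p
        \<le> C * \<rho> ^ n * exp (- \<epsilon> * (t - r)) * V ?y"
      using from_impulse[OF \<sigma> r(1,3), of ?y] n unfolding split by simp
    also have "\<dots> \<le> C * \<rho> ^ n * exp (- \<epsilon> * (t - r)) * (C * exp (- a * (r - s)) * norm x powr p)"
      using jump[of "r - s" x] r C \<rho> by (intro mult_left_mono) auto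
    also have "\<dots> \<le> C * \<rho> ^ n * exp (- \<epsilon> * (t - r)) * (C * exp (- \<epsilon> * (r - s)) * norm x powr p)"
      using slower[of "r - s"] r C \<rho> by (intro mult_left_mono mult_right_mono) auto
    also have "\<dots> = M * \<rho> ^ Suc n * (exp (- \<epsilon> * (t - r)) * exp (- \<epsilon> * (r - s))) * norm x powr p"
      using \<rho> by (simp add: M_def power2_eq_square)
    also have "exp (- \<epsilon> * (t - r)) * exp (- \<epsilon> * (r - s)) = exp (- \<epsilon> * (t - s))"
      by (simp add: algebra_simps flip: exp_add)
    finally show ?thesis
      using Suc by simp
  qed
  define q where "q = 1 / p"
  have q: "q > 0"
    using p by (simp add: q_def)
  have "norm (propagator S J \<sigma> t s) \<le> M powr q * (\<rho> powr q) ^ impulse_count \<sigma> t s * exp (- (\<epsilon> * q) * (t - s))"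
    if \<sigma>: "\<sigma> \<in> impulse_seqs_min T" and s: "s \<le> t" for \<sigma> s t
  proof (rule norm_blinfun_bound)
    let ?n = "impulse_count \<sigma> t s"
    have "(\<rho> ^ ?n) powr q = (\<rho> powr q) ^ ?n"
      using \<rho> by (simp add: powr_powr mult.commute flip: powr_realpow)
    then have root: "(M * \<rho> ^ ?n * exp (- \<epsilon> * (t - s))) powr q
        = M powr q * (\<rho> powr q) ^ ?n * exp (- (\<epsilon> * q) * (t - s))"
      using M \<rho> by (simp add: powr_mult exp_powr_real mult_ac)
    fix x
    have "norm (blinfun_apply (propagator S J \<sigma> t s) x)
        \<le> (M * \<rho> ^ ?n * exp (- \<epsilon> * (t - s))) powr q * norm x"
      unfolding q_def using bound[OF \<sigma> s, of x] p M \<rho>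
      by (intro le_root_of_powr_le) auto
    then show "norm (blinfun_apply (propagator S J \<sigma> t s) x)
        \<le> M powr q * (\<rho> powr q) ^ ?n * exp (- (\<epsilon> * q) * (t - s)) * norm x"
      unfolding root .
  qed simp
  moreover have "M powr q \<ge> 1" "\<epsilon> * q > 0"
    using M q \<epsilon> by (auto intro: ge_one_powr_ge_zero)
  moreover have "0 < \<rho> powr q" "\<rho> powr q < 1"
    using \<rho> q powr_less_mono2[of q \<rho> 1] by auto
  ultimately show ?thesis
    unfolding strongly_UGES_def by blast
qed

theorem theorem5p4:
  fixes S :: "real \<Rightarrow> 'a::banach \<Rightarrow>\<^sub>L 'a"
    and A :: "'a \<Rightarrow> 'a" and D :: "'a set"
    and J :: "'a \<Rightarrow>\<^sub>L 'a"
    and T\<^sub>m\<^sub>i\<^sub>n :: real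
  assumes "C0_semigroup S"
    and "is_generator D A S"
    and "J \<noteq> 0"
    and "blinfun_apply J ` D \<subseteq> D"
    and "T\<^sub>m\<^sub>i\<^sub>n > 0"
    and "growth_condition S J (impulse_seqs_min T\<^sub>m\<^sub>i\<^sub>n)"
  defines "cond_i \<equiv> strongly_UGES S J (impulse_seqs_min T\<^sub>m\<^sub>i\<^sub>n)"
    and "cond_ii \<equiv> (\<exists>p\<ge>1. \<exists>c\<ge>1. \<exists>\<eta>>0. \<exists>\<mu> V. 0 < \<mu> \<and> \<mu> < 1 \<and>
           timer_lyapunov S J T\<^sub>m\<^sub>i\<^sub>n p c \<eta> \<mu> V)"
    and "cond_iii \<equiv> exponentially_stable S \<and>
           (\<exists>p\<ge>1. \<exists>c\<ge>1. \<exists>\<mu> V. 0 < \<mu> \<and> \<mu> < 1 \<and>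
             uniform_lyapunov {J o\<^sub>L S \<theta> | \<theta>. \<theta> \<ge> T\<^sub>m\<^sub>i\<^sub>n} p c \<mu> V)"
  shows "(cond_i \<longleftrightarrow> cond_ii) \<and> (cond_ii \<longleftrightarrow> cond_iii) \<and> (cond_ii \<longrightarrow> exponentially_stable S)"
proof -
  have i_ii: "cond_i \<Longrightarrow> cond_ii"
    unfolding cond_i_def cond_ii_def
    using strongly_UGES_imp_timer_lyapunov assms(1,5) by blast
  have ii_iii: cond_iii if cond_ii
  proof -
    from \<open>cond_ii\<close> obtain p c \<eta> \<mu> V where V: "p \<ge> 1" "c \<ge> 1" "\<eta> > 0" "0 < \<mu>" "\<mu> < 1"
      "timer_lyapunov S J T\<^sub>m\<^sub>i\<^sub>n p c \<eta> \<mu> V"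
      unfolding cond_ii_def by blast
    obtain G where "\<forall>t\<ge>0. norm (S t) \<le> G"
      using growth_condition_imp_semigroup_bounded[OF assms(6,5)] by blast
    from timer_lyapunov_imp_uniform_lyapunov[OF assms(1) this assms(5) V(1-4,6)] V(1,2,4,5)
    show ?thesis
      unfolding cond_iii_def by blast
  qed
  have iii_i: "cond_iii \<Longrightarrow> cond_i"
    unfolding cond_iii_def cond_i_def
    using uniform_lyapunov_imp_strongly_UGES assms(5) by blast
  have "cond_iii \<Longrightarrow> exponentially_stable S"
    unfolding cond_iii_def by blast
  with i_ii ii_iii iii_i show ?thesis
    by blast
qed

end
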